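(* Let $K$ be a field of characteristic zero, let $L = Kx\oplus Ky$ be the two-dimensional Lie algebra over $K$ with $[x,y]=x$, and let $U(L)$ be its universal enveloping algebra. Then for every integer $k\ge 1$ the following identities hold in $U(L)$: $$yxy^{k} = \frac{k}{k+1}\,xy^{k+1} + \frac{1}{k+1}\,y^{k+1}x - \frac{1}{k+1}\sum_{i=1}^{k}\binom{k+1}{i}B_{k+1-i}\,xy^{i} + \frac{1}{k+1}\sum_{i=1}^{k}\binom{k+1}{i}B_{k+1-i}\,y^{i}x,$$ $$y^{k}xy = \frac{1}{k+1}\,xy^{k+1} + \frac{k}{k+1}\,y^{k+1}x + \frac{1}{k+1}\sum_{i=1}^{k}(-1)^{k+1-i}\binom{k+1}{i}B_{k+1-i}\,xy^{i} - \frac{1}{k+1}\sum_{i=1}^{k}(-1)^{k+1-i}\binom{k+1}{i}B_{k+1-i}\,y^{i}x.$$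
   Context: The Bernoulli numbers $B_n \in \mathbb{Q}$ ($n\ge 0$) are defined recursively by $\sum_{i=0}^{n}\binom{n+1}{i}B_i = n+1$ for all $n\ge 0$ (so $B_0=1$, $B_1=+\tfrac12$, $B_2=\tfrac16$, ...), regarded as elements of $K$. *)

theory Defs
  imports Complex_Main "HOL-Library.Poly_Mapping" "HOL-Algebra.QuotRing" "HOL-Algebra.Module"
begin

section \<open>Bernoulli numbers\<close>

function bernoulli :: "nat \<Rightarrow> rat" where
  "bernoulli n = 1 - (\<Sum>i\<in>{..<n}. of_nat (Suc n choose i) * bernoulli i) / of_nat (Suc n)"
  by pat_completeness auto
termination by (relation "measure id") auto

declare bernoulli.simps [simp del]

text \<open>The defining recursion; in particular the sign convention is \<open>B\<^sub>1 = + 1/2\<close>.\<close>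

lemma bernoulli_recursion:
  "(\<Sum>i\<le>n. of_nat (Suc n choose i) * bernoulli i) = of_nat n + 1"
proof -
  have "(\<Sum>i\<le>n. of_nat (Suc n choose i) * bernoulli i)
      = (\<Sum>i<n. of_nat (Suc n choose i) * bernoulli i) + of_nat (Suc n) * bernoulli n"
    by (simp flip: lessThan_Suc_atMost)
  also have "of_nat (Suc n) * bernoulli n
      = of_nat (Suc n) - (\<Sum>i<n. of_nat (Suc n choose i) * bernoulli i)"
    by (subst bernoulli.simps) (simp add: right_diff_distrib del: of_nat_Suc)
  finally show ?thesis by simp
qed


section \<open>Lie algebras\<close>

locale lie_algebra = vector_space scale
  for scale :: "'k::field \<Rightarrow> 'g::ab_group_add \<Rightarrow> 'g" +
  fixes bracket :: "'g \<Rightarrow> 'g \<Rightarrow> 'g"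
  assumes bracket_add_left: "bracket (a + b) c = bracket a c + bracket b c"
    and bracket_add_right: "bracket a (b + c) = bracket a b + bracket a c"
    and bracket_scale_left: "bracket (scale r a) b = scale r (bracket a b)"
    and bracket_scale_right: "bracket a (scale r b) = scale r (bracket a b)"
    and bracket_self: "bracket a a = 0"
    and jacobi: "bracket a (bracket b c) + bracket b (bracket c a) + bracket c (bracket a b) = 0"


section \<open>The universal enveloping algebra\<close>

text \<open>
  Words form the free monoid, written additively because \<open>'m \<Rightarrow>\<^sub>0 'k\<close> is the
  monoid algebra of an additively written monoid \<open>'m\<close>.  Hence \<open>'g word \<Rightarrow>\<^sub>0 'k\<close>
  is the free associative unital \<open>'k\<close>-algebra on the underlying set of \<open>'g\<close>.
\<close>

datatype 'g word = Word (letters: "'g list")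

instantiation word :: (type) monoid_add
begin

definition zero_word :: "'a word" where "0 = Word []"

definition plus_word :: "'a word \<Rightarrow> 'a word \<Rightarrow> 'a word" where
  "v + w = Word (letters v @ letters w)"

instance
  by standard (auto simp: zero_word_def plus_word_def)

end

definition free_algebra :: "('k::field, 'g word \<Rightarrow>\<^sub>0 'k) module" where
  "free_algebra =
    \<lparr>carrier = UNIV, mult = (*), one = 1, zero = 0, add = (+),
     smult = (\<lambda>c p. Poly_Mapping.single 0 c * p)\<rparr>"

definition free_gen :: "'g \<Rightarrow> ('g word \<Rightarrow>\<^sub>0 'k::field)" where
  "free_gen a = Poly_Mapping.single (Word [a]) 1"

text \<open>
  Modulo the first two families of relations, the free algebra on the set \<open>'g\<close>
  becomes the tensor algebra of the vector space \<open>'g\<close>; the third family is the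
  usual one defining the enveloping algebra as a quotient of the tensor algebra.
\<close>

definition enveloping_relations ::
    "('k::field \<Rightarrow> 'g::ab_group_add \<Rightarrow> 'g) \<Rightarrow> ('g \<Rightarrow> 'g \<Rightarrow> 'g) \<Rightarrow> ('g word \<Rightarrow>\<^sub>0 'k) set" where
  "enveloping_relations scale bracket =
     {free_gen (a + b) - (free_gen a + free_gen b) | a b. True}
   \<union> {free_gen (scale c a) - c \<odot>\<^bsub>free_algebra\<^esub> free_gen a | c a. True}
   \<union> {free_gen a * free_gen b - free_gen b * free_gen a - free_gen (bracket a b) | a b. True}"

definition enveloping_ideal ::
    "('k::field \<Rightarrow> 'g::ab_group_add \<Rightarrow> 'g) \<Rightarrow> ('g \<Rightarrow> 'g \<Rightarrow> 'g) \<Rightarrow> ('g word \<Rightarrow>\<^sub>0 'k) set" where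
  "enveloping_ideal scale bracket =
     Idl\<^bsub>free_algebra :: ('k, 'g word \<Rightarrow>\<^sub>0 'k) module\<^esub> (enveloping_relations scale bracket)"

text \<open>
  The quotient ring \<open>free_algebra Quot I\<close>, together with the induced scalar
  multiplication.
\<close>

definition enveloping_algebra ::
    "('k::field \<Rightarrow> 'g::ab_group_add \<Rightarrow> 'g) \<Rightarrow> ('g \<Rightarrow> 'g \<Rightarrow> 'g) \<Rightarrow> ('k, ('g word \<Rightarrow>\<^sub>0 'k) set) module" where
  "enveloping_algebra scale bracket =
    (let A = (free_algebra :: ('k, 'g word \<Rightarrow>\<^sub>0 'k) module); I = enveloping_ideal scale bracket
     in ring.extend (A Quot I)
          (module.fields (\<lambda>c X. \<Union>p\<in>X. I +>\<^bsub>A\<^esub> (c \<odot>\<^bsub>A\<^esub> p))))"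

definition enveloping_map ::
    "('k::field \<Rightarrow> 'g::ab_group_add \<Rightarrow> 'g) \<Rightarrow> ('g \<Rightarrow> 'g \<Rightarrow> 'g) \<Rightarrow> 'g \<Rightarrow> ('g word \<Rightarrow>\<^sub>0 'k) set" where
  "enveloping_map scale bracket a = enveloping_ideal scale bracket +>\<^bsub>free_algebra\<^esub> free_gen a"


text \<open>
  The quotient is well formed: it is a ring in which scalar multiplication acts on
  representatives, and \<open>enveloping_map\<close> is linear and turns brackets into commutators.
\<close>

lemma free_algebra_simps [simp]:
  "carrier free_algebra = UNIV" "mult free_algebra = (*)" "one free_algebra = 1"
  "zero free_algebra = 0" "add free_algebra = (+)"
  "smult free_algebra = (\<lambda>c p. Poly_Mapping.single 0 c * p)"
  by (simp_all add: free_algebra_def)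

lemma ring_free_algebra: "ring (free_algebra :: ('k::field, 'g word \<Rightarrow>\<^sub>0 'k) module)"
proof (rule ringI)
  show "abelian_group (free_algebra :: ('k, 'g word \<Rightarrow>\<^sub>0 'k) module)"
  proof (rule abelian_groupI)
    fix p :: "'g word \<Rightarrow>\<^sub>0 'k"
    show "\<exists>q\<in>carrier free_algebra. q \<oplus>\<^bsub>free_algebra\<^esub> p = \<zero>\<^bsub>free_algebra\<^esub>"
      by (rule bexI[of _ "- p"]) simp_all
  qed (simp_all add: ac_simps)
  show "Group.monoid (free_algebra :: ('k, 'g word \<Rightarrow>\<^sub>0 'k) module)"
    by (rule Group.monoidI) (auto simp: mult.assoc)
qed (simp_all add: distrib_left distrib_right)

lemma ideal_enveloping_ideal: "ideal (enveloping_ideal scale bracket) free_algebra"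
  unfolding enveloping_ideal_def by (rule ring.genideal_ideal[OF ring_free_algebra]) simp

lemma enveloping_algebra_simps:
  fixes scale :: "'k::field \<Rightarrow> 'g::ab_group_add \<Rightarrow> 'g"
  shows "carrier (enveloping_algebra scale bracket) = carrier (free_algebra Quot enveloping_ideal scale bracket)"
    "mult (enveloping_algebra scale bracket) = mult (free_algebra Quot enveloping_ideal scale bracket)"
    "one (enveloping_algebra scale bracket) = one (free_algebra Quot enveloping_ideal scale bracket)"
    "zero (enveloping_algebra scale bracket) = zero (free_algebra Quot enveloping_ideal scale bracket)"
    "add (enveloping_algebra scale bracket) = add (free_algebra Quot enveloping_ideal scale bracket)"
    "smult (enveloping_algebra scale bracket) = 
      (\<lambda>c X. \<Union>p\<in>X. enveloping_ideal scale bracket +>\<^bsub>free_algebra\<^esub> (Poly_Mapping.single 0 c * p))"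
  by (simp_all add: enveloping_algebra_def Let_def ring.defs module.defs FactRing_def)

lemma ring_enveloping_algebra: "ring (enveloping_algebra scale bracket)"
proof -
  interpret Q: ring "free_algebra Quot enveloping_ideal scale bracket"
    by (rule ideal.quotient_is_ring[OF ideal_enveloping_ideal])
  show ?thesis
  proof (rule ringI)
    show "abelian_group (enveloping_algebra scale bracket)"
    proof (rule abelian_groupI, unfold enveloping_algebra_simps)
      fix a assume "a \<in> carrier (free_algebra Quot enveloping_ideal scale bracket)"
      then show "\<exists>b\<in>carrier (free_algebra Quot enveloping_ideal scale bracket).
          b \<oplus>\<^bsub>free_algebra Quot enveloping_ideal scale bracket\<^esub> a
            = \<zero>\<^bsub>free_algebra Quot enveloping_ideal scale bracket\<^esub>"
        by (meson Q.a_inv_closed Q.l_neg)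
    qed (simp_all add: Q.a_assoc Q.a_comm Q.a_lcomm)
    show "Group.monoid (enveloping_algebra scale bracket)"
      by (rule Group.monoidI) (auto simp: enveloping_algebra_simps Q.m_assoc)
  qed (auto simp: enveloping_algebra_simps Q.l_distr Q.r_distr)
qed

lemma enveloping_coset_eq_iff:
  "enveloping_ideal scale bracket +>\<^bsub>free_algebra\<^esub> p = enveloping_ideal scale bracket +>\<^bsub>free_algebra\<^esub> q
    \<longleftrightarrow> p - q \<in> enveloping_ideal scale bracket" (is "?I +>\<^bsub>_\<^esub> _ = _ \<longleftrightarrow> _")
proof -
  interpret ideal ?I free_algebra by (rule ideal_enveloping_ideal)
  have "\<ominus>\<^bsub>free_algebra\<^esub> q = - q" 
    by (rule minus_equality) auto
  then have "p \<ominus>\<^bsub>free_algebra\<^esub> q = p - q" 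
    by (simp add: a_minus_def)
  then show ?thesis
    using quotient_eq_iff_same_a_r_cos[OF ideal_enveloping_ideal, of p q] by simp
qed

lemma enveloping_smult_coset:
  fixes scale :: "'k::field \<Rightarrow> 'g::ab_group_add \<Rightarrow> 'g"
  shows "c \<odot>\<^bsub>enveloping_algebra scale bracket\<^esub> (enveloping_ideal scale bracket +>\<^bsub>free_algebra\<^esub> p)
    = enveloping_ideal scale bracket +>\<^bsub>free_algebra\<^esub> (c \<odot>\<^bsub>free_algebra\<^esub> p)" (is "_ = ?I +>\<^bsub>_\<^esub> _")
proof -
  interpret ideal ?I free_algebra by (rule ideal_enveloping_ideal)
  let ?c = "Poly_Mapping.single 0 c :: 'g word \<Rightarrow>\<^sub>0 'k"
  have self: "p \<in> ?I +>\<^bsub>free_algebra\<^esub> p" using a_rcos_self[of p] by simp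
  have "?I +>\<^bsub>free_algebra\<^esub> (?c * q) = ?I +>\<^bsub>free_algebra\<^esub> (?c * p)"
    if "q \<in> ?I +>\<^bsub>free_algebra\<^esub> p" for q
  proof -
    from that obtain h where "h \<in> ?I" "q = h + p" by (auto simp: a_r_coset_def')
    then show ?thesis
      using I_l_closed[of h ?c] by (simp add: enveloping_coset_eq_iff algebra_simps)
  qed
  then have "(\<Union>q\<in>?I +>\<^bsub>free_algebra\<^esub> p. ?I +>\<^bsub>free_algebra\<^esub> (?c * q))
      = ?I +>\<^bsub>free_algebra\<^esub> (?c * p)"
    by (intro UN_constant_eq[OF self] ballI)
  then show ?thesis by (simp only: enveloping_algebra_simps free_algebra_simps)
qed

lemma enveloping_relation_mem:
  "p \<in> enveloping_relations scale bracket \<Longrightarrow> p \<in> enveloping_ideal scale bracket"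
  unfolding enveloping_ideal_def 
  using ring.genideal_self[OF ring_free_algebra, of "enveloping_relations scale bracket"] by auto

lemma enveloping_map_add:
  "enveloping_map scale bracket (a + b)
    = enveloping_map scale bracket a \<oplus>\<^bsub>enveloping_algebra scale bracket\<^esub> enveloping_map scale bracket b"
proof -
  interpret ideal "enveloping_ideal scale bracket" free_algebra by (rule ideal_enveloping_ideal)
  have "free_gen (a + b) - (free_gen a + free_gen b) \<in> enveloping_ideal scale bracket"
    by (rule enveloping_relation_mem) (unfold enveloping_relations_def, rule UnI1, rule UnI1, rule CollectI, intro exI conjI TrueI, rule HOL.refl)
  then show ?thesis
    by (simp add: enveloping_map_def enveloping_algebra_simps FactRing_def a_rcos_sum
        enveloping_coset_eq_iff)
qed

lemma enveloping_map_scale: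
  "enveloping_map scale bracket (scale c a)
    = c \<odot>\<^bsub>enveloping_algebra scale bracket\<^esub> enveloping_map scale bracket a"
  unfolding enveloping_map_def enveloping_smult_coset enveloping_coset_eq_iff
  by (rule enveloping_relation_mem) (unfold enveloping_relations_def, rule UnI1, rule UnI2, rule CollectI, intro exI conjI TrueI, rule HOL.refl)

lemma enveloping_map_bracket:
  "enveloping_map scale bracket a \<otimes>\<^bsub>enveloping_algebra scale bracket\<^esub> enveloping_map scale bracket b
    = enveloping_map scale bracket b \<otimes>\<^bsub>enveloping_algebra scale bracket\<^esub> enveloping_map scale bracket a
      \<oplus>\<^bsub>enveloping_algebra scale bracket\<^esub> enveloping_map scale bracket (bracket a b)"
proof -
  interpret ideal "enveloping_ideal scale bracket" free_algebra by (rule ideal_enveloping_ideal)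
  have "free_gen a * free_gen b - free_gen b * free_gen a - free_gen (bracket a b)
      \<in> enveloping_ideal scale bracket"
    by (rule enveloping_relation_mem) (unfold enveloping_relations_def, rule UnI2, rule CollectI, intro exI conjI TrueI, rule HOL.refl)
  then have "free_gen a * free_gen b - (free_gen b * free_gen a + free_gen (bracket a b))
      \<in> enveloping_ideal scale bracket"
    by (simp only: diff_diff_eq)
  then show ?thesis
    by (simp add: enveloping_map_def enveloping_algebra_simps FactRing_def a_rcos_sum
        rcoset_mult_add enveloping_coset_eq_iff)
qed

end

theory Submission
  imports Defs "HOL-Computational_Algebra.Polynomial"
begin

text \<open>
  In \<open>U(L)\<close> the relation \<open>[x,y] = x\<close> reads \<open>y x = x (y - 1)\<close>, so \<open>y\<^sup>i x = x (y - 1)\<^sup>i\<close> and every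
  term of the two identities has the form \<open>x p(y)\<close> for a polynomial \<open>p\<close> over \<open>K\<close>.  Comparing the
  polynomials, both identities reduce to the difference equation \<open>B\<^sub>n(t) - B\<^sub>n(t - 1) = n t\<^bsup>n-1\<^esup>\<close> of the
  Bernoulli polynomials (with \<open>B\<^sub>1 = 1/2\<close>), the second one after the reflection \<open>t \<mapsto> 1 - t\<close>.
\<close>

section \<open>The difference equation of the Bernoulli polynomials\<close>

text \<open>Coefficients of powers of \<open>s\<close> are compared: after binomial expansion and
  exchange of the two sums, the coefficient of \<open>s ^ j\<close> is governed by the recursion for
  \<open>b\<close> at \<open>m - j\<close>. With \<open>b 1 = 1/2\<close> the right side carries
  \<open>(s + 1) ^ m\<close> instead of the \<open>s ^ m\<close> of the other sign convention. The
  sequence \<open>b\<close> is abstract so that it can later consist of constant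
  polynomials.\<close>

lemma bernoulli_difference:
  fixes b :: "nat \<Rightarrow> 'a::comm_ring_1"
  assumes rec: "\<And>m. (\<Sum>i\<le>m. of_nat (Suc m choose i) * b i) = of_nat m + 1"
  shows "(\<Sum>i\<le>Suc m. of_nat (Suc m choose i) * b (Suc m - i) * ((s + 1) ^ i - s ^ i))
    = of_nat (Suc m) * (s + 1) ^ m"
proof -
  let ?n = "Suc m"
  have expand: "(s + 1) ^ i - s ^ i = (\<Sum>j<i. of_nat (i choose j) * s ^ j)" for i
    by (simp add: binomial_ring flip: lessThan_Suc_atMost)
  \<comment> \<open>The contribution to \<open>s ^ j\<close> once the sum over \<open>i\<close> is
    the inner one.\<close>
  have inner: "(\<Sum>i\<in>{j<..?n}. of_nat (?n choose i) * b (?n - i) * (of_nat (i choose j) * s ^ j))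
      = of_nat ?n * (of_nat (m choose j) * s ^ j)" if "j \<le> m" for j
  proof -
    \<comment> \<open>Substitute \<open>l = ?n - i\<close>, the index of \<open>b\<close>; since
      \<open>?n = Suc m\<close>, the bound \<open>j < i\<close> turns into
      \<open>l \<le> m - j\<close>.\<close>
    have "(\<Sum>i\<in>{j<..?n}. of_nat (?n choose i) * b (?n - i) * (of_nat (i choose j) * s ^ j))
        = (\<Sum>l\<le>m - j. of_nat (?n choose (?n - l)) * b l * (of_nat ((?n - l) choose j) * s ^ j))"
      by (rule sum.reindex_bij_witness[of _ "\<lambda>l. ?n - l" "\<lambda>i. ?n - i"]) (use that in auto)
    also have "\<dots> = (\<Sum>l\<le>m - j. of_nat (?n choose j) * s ^ j * (of_nat (Suc (m - j) choose l) * b l))"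
    proof (rule sum.cong[OF HOL.refl])
      fix l assume l: "l \<in> {..m - j}"
      \<comment> \<open>Trinomial revision pulls out a factor independent of \<open>l\<close> and
        leaves exactly the binomial coefficient of the recursion.\<close>
      have "(?n choose (?n - l)) * ((?n - l) choose j) = (?n choose j) * ((?n - j) choose (?n - l - j))"
        using choose_mult[of j "?n - l" ?n] l that by simp
      also have "(?n - j) choose (?n - l - j) = (?n - j) choose l"
        using binomial_symmetric[of l "?n - j"] l that by (simp add: diff_commute add.commute)
      finally have "of_nat (?n choose (?n - l)) * of_nat ((?n - l) choose j)
          = (of_nat (?n choose j) * of_nat (Suc (m - j) choose l) :: 'a)"
        using that by (metis Suc_diff_le of_nat_mult)
      then show "of_nat (?n choose (?n - l)) * b l * (of_nat ((?n - l) choose j) * s ^ j)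
          = of_nat (?n choose j) * s ^ j * (of_nat (Suc (m - j) choose l) * b l)"
        by (simp only: mult_ac)
    qed
    also have "\<dots> = of_nat (?n choose j) * s ^ j * of_nat (Suc (m - j))"
      unfolding sum_distrib_left[symmetric] rec by (simp add: add.commute)
    also have "\<dots> = of_nat (Suc (m - j) * (?n choose j)) * s ^ j"
      by (simp only: of_nat_mult mult_ac)
    also have "Suc (m - j) * (?n choose j) = ?n * (m choose j)"
      using binomial_absorb_comp[of ?n j] that by (simp add: Suc_diff_le)
    finally show ?thesis by (simp only: of_nat_mult mult_ac)
  qed
  \<comment> \<open>For \<open>i \<le> ?n\<close> intersecting with \<open>{..m}\<close> removes
    nothing from \<open>{..<i}\<close>; it provides a range for \<open>j\<close> that is independent
    of \<open>i\<close>, as the exchange of sums requires.\<close>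
  have "(\<Sum>i\<le>?n. of_nat (?n choose i) * b (?n - i) * ((s + 1) ^ i - s ^ i))
      = (\<Sum>i\<le>?n. \<Sum>j\<in>{..m} \<inter> {..<i}. of_nat (?n choose i) * b (?n - i) * (of_nat (i choose j) * s ^ j))"
    unfolding expand sum_distrib_left by (intro sum.cong HOL.refl) auto
  also have "\<dots> = (\<Sum>i\<in>{..?n}. \<Sum>j\<in>{j \<in> {..m}. j < i}.
      of_nat (?n choose i) * b (?n - i) * (of_nat (i choose j) * s ^ j))"
    by (intro sum.cong HOL.refl) auto
  also have "\<dots> = (\<Sum>j\<in>{..m}. \<Sum>i\<in>{i \<in> {..?n}. j < i}.
      of_nat (?n choose i) * b (?n - i) * (of_nat (i choose j) * s ^ j))"
    by (rule sum.swap_restrict) auto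
  also have "\<dots> = (\<Sum>j\<le>m. \<Sum>i\<in>{j<..?n}.
      of_nat (?n choose i) * b (?n - i) * (of_nat (i choose j) * s ^ j))"
    by (intro sum.cong HOL.refl) auto
  also have "\<dots> = (\<Sum>j\<le>m. of_nat ?n * (of_nat (m choose j) * s ^ j))"
    by (intro sum.cong HOL.refl inner) simp
  also have "\<dots> = of_nat ?n * (s + 1) ^ m"
    by (simp add: binomial_ring sum_distrib_left)
  finally show ?thesis .
qed

text \<open>The previous lemma at \<open>s = t - 1\<close>, without its two extreme terms: the one
  for \<open>i = 0\<close> vanishes, and the one for \<open>i = Suc k\<close> is
  \<open>t ^ Suc k - (t - 1) ^ Suc k\<close> because \<open>b 0 = 1\<close>.\<close>

lemma bernoulli_difference_sum:
  fixes b :: "nat \<Rightarrow> 'a::comm_ring_1"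
  assumes "\<And>m. (\<Sum>i\<le>m. of_nat (Suc m choose i) * b i) = of_nat m + 1"
    and b0: "b 0 = 1"
  shows "(\<Sum>i\<in>{1..k}. of_nat (Suc k choose i) * b (Suc k - i) * (t ^ i - (t - 1) ^ i))
    = of_nat (Suc k) * t ^ k - t ^ Suc k + (t - 1) ^ Suc k"
proof -
  have "(\<Sum>i\<le>Suc k. of_nat (Suc k choose i) * b (Suc k - i) * (t ^ i - (t - 1) ^ i))
      = of_nat (Suc k) * t ^ k"
    using bernoulli_difference[of b k "t - 1"] assms(1) by simp
  moreover have "{..Suc k} = insert 0 (insert (Suc k) {1..k})" by auto
  ultimately show ?thesis using b0 by (simp add: algebra_simps)
qed

text \<open>Replacing \<open>t\<close> by \<open>1 - t\<close> turns the difference of i-th powers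
  into \<open>(-1) ^ i * ((t - 1) ^ i - t ^ i)\<close>. Up to the common factor
  \<open>(-1) ^ k\<close> this is the alternating sign, so the non-alternating sum can be
  quoted.\<close>

lemma bernoulli_difference_sum_alternating:
  fixes b :: "nat \<Rightarrow> 'a::comm_ring_1"
  assumes "\<And>m. (\<Sum>i\<le>m. of_nat (Suc m choose i) * b i) = of_nat m + 1"
    and "b 0 = 1"
  shows "(\<Sum>i\<in>{1..k}. (-1) ^ (Suc k - i) * of_nat (Suc k choose i) * b (Suc k - i)
      * (t ^ i - (t - 1) ^ i))
    = of_nat (Suc k) * (t - 1) ^ k - t ^ Suc k + (t - 1) ^ Suc k"
proof -
  have reflect: "(1 - t) ^ i = (-1) ^ i * (t - 1) ^ i" "(- t) ^ i = (-1) ^ i * t ^ i" for i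
    using power_mult_distrib[of "-1" "t - 1" i] power_mult_distrib[of "-1" t i] by simp_all
  have sign: "(-1) ^ (Suc k - i) = - ((-1) ^ k * (-1) ^ i :: 'a)" if "i \<le> Suc k" for i
    using that by (cases "even i"; cases "even k") auto
  have "(\<Sum>i\<in>{1..k}. (-1) ^ (Suc k - i) * of_nat (Suc k choose i) * b (Suc k - i)
        * (t ^ i - (t - 1) ^ i))
      = (-1) ^ k * (\<Sum>i\<in>{1..k}. of_nat (Suc k choose i) * b (Suc k - i)
          * ((1 - t) ^ i - (1 - t - 1) ^ i))"
    unfolding sum_distrib_left by (intro sum.cong HOL.refl) (simp add: sign reflect algebra_simps)
  also have "\<dots> = (-1) ^ k * (of_nat (Suc k) * (1 - t) ^ k - (1 - t) ^ Suc k + (1 - t - 1) ^ Suc k)"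
    by (subst bernoulli_difference_sum[OF assms]) simp
  also have "\<dots> = ((-1) ^ k * (-1) ^ k) * (of_nat (Suc k) * (t - 1) ^ k - t ^ Suc k + (t - 1) ^ Suc k)"
    by (simp add: reflect algebra_simps)
  also have "(-1) ^ k * (-1) ^ k = (1 :: 'a)"
    by (simp flip: power_mult_distrib)
  finally show ?thesis by simp
qed

section \<open>Both identities as identities of polynomials over K\<close>

lemma of_rat_bernoulli_recursion:
  "(\<Sum>i\<le>m. of_nat (Suc m choose i) * [:of_rat (bernoulli i) :: 'k::field_char_0:]) = of_nat m + 1"
proof -
  have "(\<Sum>i\<le>m. of_nat (Suc m choose i) * of_rat (bernoulli i)) = (of_nat m + 1 :: 'k)"
    using arg_cong[OF bernoulli_recursion[of m], of "of_rat :: rat \<Rightarrow> 'k"]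
    by (simp add: of_rat_sum of_rat_mult of_rat_add)
  then have "[:\<Sum>i\<le>m. of_nat (Suc m choose i) * of_rat (bernoulli i):] = [:of_nat m + 1 :: 'k:]"
    by simp
  moreover have "[:\<Sum>i\<in>S. f i:] = (\<Sum>i\<in>S. [:f i:])" for S :: "nat set" and f :: "nat \<Rightarrow> 'k"
    by (induction S rule: infinite_finite_induct) (simp, simp, metis add.right_neutral add_pCons sum.insert)
  ultimately show ?thesis
    by (simp add: of_nat_poly one_pCons mult.commute)
qed

lemma of_rat_bernoulli_0: "[:of_rat (bernoulli 0) :: 'k::field_char_0:] = 1"
  using of_rat_bernoulli_recursion[of 0, where 'k='k] by simp

lemma smult_of_nat_cancel:
  fixes p q :: "'k::field_char_0 poly"
  shows "smult (of_nat (k + 1)) p = smult (of_nat (k + 1)) q \<longleftrightarrow> p = q"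
proof -
  have "of_nat (k + 1) \<noteq> (0 :: 'k)"
    by (simp only: of_nat_eq_0_iff)
  then show ?thesis
    using smult_eq_0_iff[of "of_nat (k + 1)" "p - q"]
    by (simp only: smult_diff_right right_minus_eq simp_thms)
qed

text \<open>The first identity with the left factor x removed: \<open>x y^i\<close> corresponds to
  \<open>t ^ i\<close> and \<open>y^i x\<close> to \<open>(t - 1) ^ i\<close>. After multiplication
  by \<open>k + 1\<close>, the difference sum cancels \<open>(t - 1) ^ (k + 1)\<close> and leaves
  \<open>(k + 1) * (t ^ (k + 1) - t ^ k)\<close>.\<close>

lemma bernoulli_poly_identity:
  fixes t :: "'k::field_char_0 poly" and k :: nat
  defines "coef \<equiv> \<lambda>i. of_nat (k + 1 choose i) * of_rat (bernoulli (k + 1 - i)) :: 'k"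
  shows "(t - 1) * t ^ k =
      smult (of_nat k / of_nat (k + 1)) (t ^ (k + 1)) + smult (1 / of_nat (k + 1)) ((t - 1) ^ (k + 1))
    - smult (1 / of_nat (k + 1)) (\<Sum>i\<in>{1..k}. smult (coef i) (t ^ i))
    + smult (1 / of_nat (k + 1)) (\<Sum>i\<in>{1..k}. smult (coef i) ((t - 1) ^ i))"
    (is "?lhs = ?rhs")
proof -
  have "smult (of_nat (k + 1)) ?rhs = of_nat k * t ^ (k + 1) + (t - 1) ^ (k + 1)
      - (\<Sum>i\<in>{1..k}. of_nat (k + 1 choose i) * [:of_rat (bernoulli (k + 1 - i)):] * (t ^ i - (t - 1) ^ i))"
    by (simp add: smult_add_right smult_diff_right coef_def of_nat_poly sum_subtractf right_diff_distrib mult.commute[of "of_nat (_ choose _)"]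
        del: of_nat_add of_nat_Suc)
  also have "\<dots> = of_nat (k + 1) * ?lhs"
    unfolding Suc_eq_plus1[symmetric]
      bernoulli_difference_sum[OF of_rat_bernoulli_recursion of_rat_bernoulli_0]
    by (simp add: algebra_simps)
  also have "\<dots> = smult (of_nat (k + 1)) ?lhs"
    by (simp add: of_nat_poly)
  finally show ?thesis
    by (simp only: smult_of_nat_cancel)
qed

text \<open>The second identity under the same correspondence. Here the alternating sum cancels
  \<open>t ^ (k + 1)\<close> and leaves
  \<open>(k + 1) * ((t - 1) ^ (k + 1) + (t - 1) ^ k)\<close>.\<close>

lemma bernoulli_poly_identity_alternating:
  fixes t :: "'k::field_char_0 poly" and k :: nat
  defines "coef \<equiv> \<lambda>i. (-1) ^ (k + 1 - i) * of_nat (k + 1 choose i) * of_rat (bernoulli (k + 1 - i)) :: 'k"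
  shows "(t - 1) ^ k * t =
      smult (1 / of_nat (k + 1)) (t ^ (k + 1)) + smult (of_nat k / of_nat (k + 1)) ((t - 1) ^ (k + 1))
    + smult (1 / of_nat (k + 1)) (\<Sum>i\<in>{1..k}. smult (coef i) (t ^ i))
    - smult (1 / of_nat (k + 1)) (\<Sum>i\<in>{1..k}. smult (coef i) ((t - 1) ^ i))"
    (is "?lhs = ?rhs")
proof -
  have "smult (of_nat (k + 1)) ?rhs = t ^ (k + 1) + of_nat k * (t - 1) ^ (k + 1)
      + (\<Sum>i\<in>{1..k}. (-1) ^ (k + 1 - i) * of_nat (k + 1 choose i) * [:of_rat (bernoulli (k + 1 - i)):]
          * (t ^ i - (t - 1) ^ i))"
  proof -
    \<comment> \<open>The sign in \<open>coef\<close> is a scalar, while the difference sum is taken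
      in the polynomial ring and has its sign there.\<close>
    have sgn: "smult ((-1) ^ n * a) p = (-1) ^ n * smult a p" for n and a :: 'k and p
      by (cases "even n") simp_all
    show ?thesis
      unfolding coef_def mult.assoc sgn
      by (simp add: smult_add_right smult_diff_right of_nat_poly sum_subtractf right_diff_distrib
        mult.commute[of "of_nat (_ choose _)"] del: of_nat_add of_nat_Suc)
  qed
  also have "\<dots> = of_nat (k + 1) * ?lhs"
    unfolding Suc_eq_plus1[symmetric]
      bernoulli_difference_sum_alternating[OF of_rat_bernoulli_recursion of_rat_bernoulli_0]
    by (simp add: algebra_simps)
  also have "\<dots> = smult (of_nat (k + 1)) ?lhs"
    by (simp add: of_nat_poly)
  finally show ?thesis
    by (simp only: smult_of_nat_cancel)
qed

section \<open>Polynomials evaluated in a monoid algebra\<close>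

text \<open>Horner evaluation in a possibly noncommutative algebra, with scalars embedded at the
  neutral element. The factor \<open>y\<close> stands on the right, so that \<open>pCons 0\<close>
  is right multiplication by \<open>y\<close>.\<close>

definition eval_poly_mapping :: "'k::field poly \<Rightarrow> ('m::monoid_add \<Rightarrow>\<^sub>0 'k) \<Rightarrow> ('m \<Rightarrow>\<^sub>0 'k)" where
  "eval_poly_mapping p y = fold_coeffs (\<lambda>a q. Poly_Mapping.single 0 a + q * y) p 0"

lemma eval_poly_mapping_0 [simp]: "eval_poly_mapping 0 y = 0"
  by (simp add: eval_poly_mapping_def)

lemma eval_poly_mapping_pCons [simp]:
  "eval_poly_mapping (pCons a p) y = Poly_Mapping.single 0 a + eval_poly_mapping p y * y"
  by (cases "p = 0 \<and> a = 0") (auto simp: eval_poly_mapping_def)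

lemma eval_poly_mapping_add:
  "eval_poly_mapping (p + q) y = eval_poly_mapping p y + eval_poly_mapping q y"
  by (induction p q rule: poly_induct2) (simp_all add: single_add algebra_simps)

text \<open>Scalars are central because they sit at the neutral element of the monoid; the induction
  adds one monomial at a time.\<close>

lemma single_0_commute:
  fixes p :: "'m::monoid_add \<Rightarrow>\<^sub>0 'k::field"
  shows "p * Poly_Mapping.single 0 c = Poly_Mapping.single 0 c * p"
proof (induction p rule: update_induct)
  case (update q m a)
  then have "Poly_Mapping.update m a q = q + Poly_Mapping.single m a"
    by (intro poly_mapping_eqI) (auto simp: lookup_update lookup_add lookup_single in_keys_iff)
  with update show ?case by (simp add: mult_single algebra_simps)
qed simp

lemma eval_poly_mapping_smult:
  "eval_poly_mapping (smult c p) y = Poly_Mapping.single 0 c * eval_poly_mapping p y"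
  by (induction p) (simp_all add: mult_single algebra_simps)

lemma eval_poly_mapping_diff:
  "eval_poly_mapping (p - q) y = eval_poly_mapping p y - eval_poly_mapping q y"
  using eval_poly_mapping_add[of "p - q" q y] by simp

section \<open>The quotient map onto the enveloping algebra\<close>

text \<open>Extends \<open>enveloping_map\<close> from generators to the whole free algebra, so that
  computations in the quotient can be made on representatives.\<close>

definition enveloping_proj ::
    "('k::field \<Rightarrow> 'g::ab_group_add \<Rightarrow> 'g) \<Rightarrow> ('g \<Rightarrow> 'g \<Rightarrow> 'g) \<Rightarrow> ('g word \<Rightarrow>\<^sub>0 'k) \<Rightarrow> ('g word \<Rightarrow>\<^sub>0 'k) set" where
  "enveloping_proj scale bracket p = enveloping_ideal scale bracket +>\<^bsub>free_algebra\<^esub> p"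

context
  fixes scale :: "'k::field \<Rightarrow> 'g::ab_group_add \<Rightarrow> 'g"
    and bracket :: "'g \<Rightarrow> 'g \<Rightarrow> 'g"
    and U :: "('k, ('g word \<Rightarrow>\<^sub>0 'k) set) module" (structure)
  assumes U_def: "U = enveloping_algebra scale bracket"
begin

abbreviation (input) proj :: "('g word \<Rightarrow>\<^sub>0 'k) \<Rightarrow> ('g word \<Rightarrow>\<^sub>0 'k) set"
  where "proj \<equiv> enveloping_proj scale bracket"

interpretation I: ideal "enveloping_ideal scale bracket" free_algebra
  by (rule ideal_enveloping_ideal)

interpretation U: ring U
  unfolding U_def by (rule ring_enveloping_algebra)

lemma enveloping_proj_closed: "proj p \<in> carrier U"
  by (auto simp: U_def enveloping_proj_def enveloping_algebra_simps FactRing_def A_RCOSETS_def')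

lemma enveloping_proj_eq_iff: "proj p = proj q \<longleftrightarrow> p - q \<in> enveloping_ideal scale bracket"
  by (simp add: enveloping_proj_def enveloping_coset_eq_iff)

lemma enveloping_proj_add: "proj p \<oplus> proj q = proj (p + q)"
  by (simp add: U_def enveloping_proj_def enveloping_algebra_simps FactRing_def I.a_rcos_sum)

lemma enveloping_proj_mult: "proj p \<otimes> proj q = proj (p * q)"
  by (simp add: U_def enveloping_proj_def enveloping_algebra_simps FactRing_def
      I.rcoset_mult_add)

lemma enveloping_proj_smult: "c \<odot> proj p = proj (Poly_Mapping.single 0 c * p)"
  by (simp add: U_def enveloping_proj_def enveloping_smult_coset)

lemma enveloping_proj_one: "\<one> = proj 1"
  by (simp add: U_def enveloping_proj_def enveloping_algebra_simps FactRing_def)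

lemma enveloping_proj_zero: "\<zero> = proj 0"
  using enveloping_proj_add[of 0 0] enveloping_proj_closed[of 0] by (simp add: U.add.l_cancel_one')

lemma enveloping_proj_diff: "proj p \<ominus> proj q = proj (p - q)"
proof -
  have "proj (- q) = \<ominus> proj q"
    by (rule U.minus_equality[symmetric])
      (simp_all add: enveloping_proj_add enveloping_proj_zero enveloping_proj_closed)
  then show ?thesis
    using enveloping_proj_add[of p "- q"] by (simp add: a_minus_def)
qed

section \<open>Elements x p(y) and the normal form of y^i x y^j\<close>

context
  fixes x y :: 'g
  assumes bracket_xy: "bracket x y = x"
begin

text \<open>This map is linear in \<open>p\<close>, so a linear identity between polynomials yields
  one in the enveloping algebra.\<close>

definition x_times_poly :: "'k poly \<Rightarrow> ('g word \<Rightarrow>\<^sub>0 'k) set" where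
  "x_times_poly p = proj (free_gen x * eval_poly_mapping p (free_gen y))"

lemma proj_y_x: "proj (free_gen y * free_gen x) = proj (free_gen x * free_gen y - free_gen x)"
proof -
  have "free_gen x * free_gen y - free_gen y * free_gen x - free_gen (bracket x y)
      \<in> enveloping_ideal scale bracket"
    by (rule enveloping_relation_mem) (unfold enveloping_relations_def, blast)
  then have "proj (free_gen x * free_gen y - free_gen x) = proj (free_gen y * free_gen x)"
    by (simp add: enveloping_proj_eq_iff bracket_xy algebra_simps)
  then show ?thesis ..
qed

lemma x_times_poly_closed: "x_times_poly p \<in> carrier U"
  by (simp add: x_times_poly_def enveloping_proj_closed)

lemma x_times_poly_add: "x_times_poly p \<oplus> x_times_poly q = x_times_poly (p + q)"
  by (simp add: x_times_poly_def enveloping_proj_add eval_poly_mapping_add algebra_simps)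

lemma x_times_poly_diff: "x_times_poly p \<ominus> x_times_poly q = x_times_poly (p - q)"
  by (simp add: x_times_poly_def enveloping_proj_diff eval_poly_mapping_diff algebra_simps)

lemma x_times_poly_smult: "c \<odot> x_times_poly p = x_times_poly (smult c p)"
  by (simp add: x_times_poly_def enveloping_proj_smult eval_poly_mapping_smult
      single_0_commute[symmetric] mult.assoc)

lemma x_times_poly_finsum:
  "finite S \<Longrightarrow> (\<Oplus>i\<in>S. x_times_poly (f i)) = x_times_poly (\<Sum>i\<in>S. f i)"
  by (induction S rule: finite_induct)
    (simp_all add: x_times_poly_add x_times_poly_closed, simp add: x_times_poly_def enveloping_proj_zero)

lemma x_times_poly_mult_y:
  "x_times_poly p \<otimes> proj (free_gen y) = x_times_poly (p * [:0, 1:])" for p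
  by (simp add: x_times_poly_def enveloping_proj_mult mult.assoc mult.commute[of p])

lemma x_times_poly_1: "x_times_poly 1 = proj (free_gen x)"
  by (simp add: x_times_poly_def one_pCons)

lemma y_mult_x_times_poly: "proj (free_gen y) \<otimes> x_times_poly p = x_times_poly (([:0, 1:] - 1) * p)"
proof -
  have "proj (free_gen y) \<otimes> x_times_poly p
      = proj (free_gen y * free_gen x) \<otimes> proj (eval_poly_mapping p (free_gen y))"
    by (simp add: x_times_poly_def enveloping_proj_mult mult.assoc)
  also have "\<dots> = proj (free_gen x) \<otimes> proj (free_gen y * eval_poly_mapping p (free_gen y)) \<ominus> x_times_poly p"
    unfolding proj_y_x
    by (simp add: x_times_poly_def enveloping_proj_mult enveloping_proj_diff algebra_simps)
  \<comment> \<open>Powers of y commute with y and scalars are central.\<close>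
  also have "free_gen y * eval_poly_mapping p (free_gen y) = eval_poly_mapping p (free_gen y) * free_gen y"
    by (induction p) (simp_all add: single_0_commute distrib_left distrib_right flip: mult.assoc)
  also have "proj (free_gen x) \<otimes> proj (eval_poly_mapping p (free_gen y) * free_gen y) = x_times_poly (pCons 0 p)"
    by (simp add: x_times_poly_def enveloping_proj_mult)
  finally show ?thesis
    by (simp add: x_times_poly_diff left_diff_distrib)
qed

text \<open>Each y to the left of x contributes a factor \<open>t - 1\<close>, each y to the right a
  factor \<open>t\<close>, where \<open>t = [:0, 1:]\<close>. The induction on \<open>j\<close> adds
  right factors; its base case is an induction on \<open>i\<close> adding left factors.\<close>

lemma y_power_x_y_power:
  "proj (free_gen y) [^] i \<otimes> proj (free_gen x) \<otimes> proj (free_gen y) [^] j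
    = x_times_poly (([:0, 1:] - 1) ^ i * [:0, 1:] ^ j)" for i j :: nat
proof (induction j)
  case 0
  have "proj (free_gen y) [^] i \<otimes> proj (free_gen x) = x_times_poly (([:0, 1:] - 1) ^ i)"
  proof (induction i)
    case 0
    then show ?case by (simp add: x_times_poly_1 enveloping_proj_closed)
  next
    case (Suc i)
    \<comment> \<open>The new factor has to be split off on the left, where
      \<open>y_mult_x_times_poly\<close> can absorb it.\<close>
    have "proj (free_gen y) [^] Suc i \<otimes> proj (free_gen x)
        = proj (free_gen y) \<otimes> (proj (free_gen y) [^] i \<otimes> proj (free_gen x))"
      using U.nat_pow_Suc2[OF enveloping_proj_closed, of "free_gen y" i]
      by (simp add: U.m_assoc enveloping_proj_closed)
    then show ?case by (simp add: Suc y_mult_x_times_poly)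
  qed
  then show ?case by (simp add: x_times_poly_closed)
next
  case (Suc j)
  have "proj (free_gen y) [^] i \<otimes> proj (free_gen x) \<otimes> proj (free_gen y) [^] Suc j
      = (proj (free_gen y) [^] i \<otimes> proj (free_gen x) \<otimes> proj (free_gen y) [^] j) \<otimes> proj (free_gen y)"
    by (simp add: U.m_assoc enveloping_proj_closed)
  then show ?case
    by (simp only: Suc x_times_poly_mult_y power_Suc2 mult.assoc)
qed

lemmas x_times_poly_simps =
  x_times_poly_add x_times_poly_diff x_times_poly_smult x_times_poly_finsum[OF finite_atLeastAtMost]

lemma x_y_power: "proj (free_gen x) \<otimes> proj (free_gen y) [^] j = x_times_poly ([:0, 1:] ^ j)"
  for j :: nat
  using y_power_x_y_power[of 0 j] by (simp add: enveloping_proj_closed)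

lemma y_power_x: "proj (free_gen y) [^] i \<otimes> proj (free_gen x) = x_times_poly (([:0, 1:] - 1) ^ i)"
  for i :: nat
  using y_power_x_y_power[of i 0] by (simp add: enveloping_proj_closed)

end

end

theorem proposition4p2:
  fixes scale :: "'k::field_char_0 \<Rightarrow> 'g::ab_group_add \<Rightarrow> 'g"
    and bracket :: "'g \<Rightarrow> 'g \<Rightarrow> 'g"
    and x y :: 'g
    and U :: "('k, ('g word \<Rightarrow>\<^sub>0 'k) set) module" (structure)
    and X Y :: "('g word \<Rightarrow>\<^sub>0 'k) set"
    and k :: nat
  assumes "lie_algebra scale bracket"
    and "x \<noteq> y"
    and "\<not> module.dependent scale {x, y}"
    and "module.span scale {x, y} = UNIV"
    and "bracket x y = x"
    and "U = enveloping_algebra scale bracket"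
    and "X = enveloping_map scale bracket x"
    and "Y = enveloping_map scale bracket y"
    and "k \<ge> 1"
  shows "(Y \<otimes> X \<otimes> Y [^] k =
        (of_nat k / of_nat (k + 1)) \<odot> (X \<otimes> Y [^] (k + 1))
      \<oplus> (1 / of_nat (k + 1)) \<odot> (Y [^] (k + 1) \<otimes> X)
      \<ominus> (1 / of_nat (k + 1)) \<odot>
          (\<Oplus>i\<in>{1..k}. (of_nat ((k + 1) choose i) * of_rat (bernoulli (k + 1 - i))) \<odot> (X \<otimes> Y [^] i))
      \<oplus> (1 / of_nat (k + 1)) \<odot>
          (\<Oplus>i\<in>{1..k}. (of_nat ((k + 1) choose i) * of_rat (bernoulli (k + 1 - i))) \<odot> (Y [^] i \<otimes> X)))
      \<and> (Y [^] k \<otimes> X \<otimes> Y =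
        (1 / of_nat (k + 1)) \<odot> (X \<otimes> Y [^] (k + 1))
      \<oplus> (of_nat k / of_nat (k + 1)) \<odot> (Y [^] (k + 1) \<otimes> X)
      \<oplus> (1 / of_nat (k + 1)) \<odot>
          (\<Oplus>i\<in>{1..k}. ((-1) ^ (k + 1 - i) * of_nat ((k + 1) choose i) * of_rat (bernoulli (k + 1 - i))) \<odot> (X \<otimes> Y [^] i))
      \<ominus> (1 / of_nat (k + 1)) \<odot>
          (\<Oplus>i\<in>{1..k}. ((-1) ^ (k + 1 - i) * of_nat ((k + 1) choose i) * of_rat (bernoulli (k + 1 - i))) \<odot> (Y [^] i \<otimes> X)))"
proof -
  have X: "X = enveloping_proj scale bracket (free_gen x)"
    and Y: "Y = enveloping_proj scale bracket (free_gen y)"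
    by (simp_all add: assms(7,8) enveloping_map_def enveloping_proj_def)
  note ctx = assms(6,5)
  interpret ring U
    unfolding assms(6) by (rule ring_enveloping_algebra)
  \<comment> \<open>Reading the single \<open>Y\<close> as a first power makes both left sides
    instances of the normal form, with exponents \<open>1, k\<close> and
    \<open>k, 1\<close>.\<close>
  have "Y [^] (1::nat) = Y"
    using enveloping_proj_closed[OF ctx(1)] by (simp add: Y)
  then have yxk: "Y \<otimes> X \<otimes> Y [^] k = x_times_poly scale bracket x y (([:0, 1:] - 1) * [:0, 1:] ^ k)"
    and ykx: "Y [^] k \<otimes> X \<otimes> Y = x_times_poly scale bracket x y (([:0, 1:] - 1) ^ k * [:0, 1:])"
    using y_power_x_y_power[OF ctx, of 1 k] y_power_x_y_power[OF ctx, of k 1] by (simp_all add: X Y)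
  \<comment> \<open>Linearity collects each right side into one \<open>x_times_poly\<close>; what
    remains are the two polynomial identities at \<open>t = [:0, 1:]\<close>.\<close>
  show ?thesis
    unfolding yxk ykx unfolding X Y y_power_x[OF ctx] x_y_power[OF ctx] x_times_poly_simps[OF ctx]
    by (intro conjI arg_cong[where f = "x_times_poly scale bracket x y"]
        bernoulli_poly_identity bernoulli_poly_identity_alternating)
qed

end
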